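(* Let $(a_1, \dots, a_n)$ be a list of $n$ positive integers and let $m := \sum_{i=1}^n a_i$. Let $T$ be the DDG tree of the Fast Loaded Dice Roller (FLDR) for $(a_1,\dots,a_n)$, encoded finitely with back-edges as described in the context. Then $T$ has at most $2(n+1)\lceil \log m \rceil$ nodes.
   Context: All logarithms are base 2. DDG trees. A discrete distribution generating (DDG) tree over a finite outcome set $\{1,\dots,N\}$ is a (possibly infinite) rooted binary tree in which every internal node has exactly two children and every leaf is labeled with an element of $\{1,\dots,N\}$. The root is at level $0$. The tree represents the following sampling algorithm: starting at the root, draw an independent fair bit $B \in \{0,1\}$ and move to the left child if $B=0$ and to the right child if $B=1$; if the child is a leaf, return its label and halt; otherwise draw a new bit and repeat from that child. Writing $d(x)$ for the level of a node $x$, the output distribution gives outcome $i$ probability $\sum_{x \text{ leaf labeled } i} 2^{-d(x)}$, and the expected number of bits consumed is $\sum_{x \text{ leaf}} d(x) 2^{-d(x)}$. A DDG tree is entropy-optimal for a probability distribution if this is its output distribution and its expected number of bits consumed is minimal among all DDG trees with the same output distribution. By a theorem of Knuth and Yao (for distributions on more than one outcome), an entropy-optimal tree contains exactly one leaf labeled $i$ at level $j$ if and only if the coefficient of $2^{-j}$ in the binary expansion of the probability of $i$ is $1$ (using the terminating expansion for dyadic rationals), and otherwise contains no such leaf. A tree may be encoded finitely by using back-edges: an edge from a node back to an earlier node, meaning that the sampling process continues from that earlier node. FLDR. Given positive integers $(a_1,\dots,a_n)$ with sum $m$, FLDR samples $i$ with probability $a_i/m$ as follows. (1) Let $k := \lceil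 \log m \rceil$ and define the proposal distribution on $\{1,\dots,n+1\}$ by $q := (a_1/2^k, \dots, a_n/2^k, 1 - m/2^k)$. (2) Sample $X \sim q$ using an entropy-optimal DDG tree $T_q$ for $q$, with fresh independent fair bits. (3) If $X \le n$, return $X$; otherwise go to step (2). The (finitely encoded) DDG tree $T$ of FLDR is $T_q$ together with a back-edge from each leaf labeled $n+1$ to the root. Its nodes are the nodes of $T_q$.
   Formalization: The formal theorem assumes m > 1; this excludes only the list (1), where the bound 2(n+1)⌈log m⌉ is 0 although T has at least a root node, and the empty list, where log m is undefined. *)

theory Defs
  imports "HOL-Analysis.Analysis"
begin

text \<open>
  A codatatype, since DDG trees may be infinite.  The tree that consists of a single leaf is
  allowed; it halts without consuming any bits.
\<close>

codatatype (labels: 'a) ddg = Leaf 'a | Branch "'a ddg" "'a ddg"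

text \<open>
  A node is identified with the sequence of bits that leads to it from the root
  (\<open>False\<close> is the bit 0, going left); its level is the length of that sequence.
\<close>

fun subtree_at :: "bool list \<Rightarrow> 'a ddg \<Rightarrow> 'a ddg option" where
  "subtree_at [] t = Some t"
| "subtree_at (b # bs) t =
     (case t of Leaf i \<Rightarrow> None | Branch l r \<Rightarrow> subtree_at bs (if b then r else l))"

definition nodes :: "'a ddg \<Rightarrow> bool list set" where
  "nodes t = {x. subtree_at x t \<noteq> None}"

definition leaves_labeled :: "'a ddg \<Rightarrow> 'a \<Rightarrow> bool list set" where
  "leaves_labeled t i = {x. subtree_at x t = Some (Leaf i)}"

definition leaves :: "'a ddg \<Rightarrow> bool list set" where
  "leaves t = {x. \<exists>i. subtree_at x t = Some (Leaf i)}"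

definition ddg_tree_over :: "'a set \<Rightarrow> 'a ddg \<Rightarrow> bool" where
  "ddg_tree_over A t \<longleftrightarrow> labels t \<subseteq> A"

definition has_output_distribution :: "'a set \<Rightarrow> 'a ddg \<Rightarrow> ('a \<Rightarrow> real) \<Rightarrow> bool" where
  "has_output_distribution A t p \<longleftrightarrow>
     (\<forall>i\<in>A. ((\<lambda>x. 1 / 2 ^ length x) has_sum p i) (leaves_labeled t i))"

text \<open>Extended-valued, because the series may diverge for an infinite tree.\<close>

definition expected_bits :: "'a ddg \<Rightarrow> ennreal" where
  "expected_bits t = (\<Sum>\<^sub>\<infinity>x\<in>leaves t. ennreal (real (length x) / 2 ^ length x))"

definition entropy_optimal :: "'a set \<Rightarrow> ('a \<Rightarrow> real) \<Rightarrow> 'a ddg \<Rightarrow> bool" where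
  "entropy_optimal A p t \<longleftrightarrow>
     ddg_tree_over A t \<and> has_output_distribution A t p \<and>
     (\<forall>t'. ddg_tree_over A t' \<and> has_output_distribution A t' p \<longrightarrow>
        expected_bits t \<le> expected_bits t')"

text \<open>
  A finite encoding is a tree together with a set of back-edges \<open>(source, target)\<close>
  between its nodes; reaching the source of a back-edge continues the sampling at its target.
\<close>

record 'a encoded_ddg =
  underlying_tree :: "'a ddg"
  back_edges :: "(bool list \<times> bool list) set"

definition encoded_nodes :: "'a encoded_ddg \<Rightarrow> bool list set" where
  "encoded_nodes T = nodes (underlying_tree T)"

text \<open>
  The weight \<open>a\<^sub>i\<close> is \<open>a ! (i - 1)\<close>; the outcome \<open>length a + 1\<close> is rejection.
\<close>

definition fldr_depth :: "nat list \<Rightarrow> nat" where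
  "fldr_depth a = nat \<lceil>log 2 (real (sum_list a))\<rceil>"

definition fldr_proposal :: "nat list \<Rightarrow> nat \<Rightarrow> real" where
  "fldr_proposal a i =
     (if 1 \<le> i \<and> i \<le> length a then real (a ! (i - 1)) / 2 ^ fldr_depth a
      else if i = length a + 1 then 1 - real (sum_list a) / 2 ^ fldr_depth a
      else 0)"

text \<open>
  A predicate rather than a function: entropy-optimal trees are unique only up to rearrangement,
  and FLDR may use any of them.
\<close>

definition is_fldr_tree :: "nat list \<Rightarrow> nat encoded_ddg \<Rightarrow> bool" where
  "is_fldr_tree a T \<longleftrightarrow>
     entropy_optimal {1..length a + 1} (fldr_proposal a) (underlying_tree T) \<and>
     back_edges T = (\<lambda>x. (x, [])) ` leaves_labeled (underlying_tree T) (length a + 1)"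

end

theory Submission imports Defs begin

text \<open>
  The proposal probabilities are \<open>c i / 2 ^ k\<close> with natural numbers \<open>c i\<close> that sum to \<open>2 ^ k\<close>.  The
  expected number of bits is the sum over \<open>j \<ge> 1\<close> of the mass of the leaves at level at least \<open>j\<close>,
  and for each label and each \<open>j \<le> k + 1\<close> this mass is bounded below by a remainder of \<open>c i\<close>.  A tree
  whose leaves follow the binary expansions attains all these bounds, so an entropy-optimal
  tree does too.  Hence it has no leaves below level \<open>k\<close> and at most one leaf per label and level,
  and counting the nodes of a full binary tree by its leaves gives the bound.
\<close>

section \<open>Paths in binary trees\<close>

lemma leaves_labeled_Leaf [simp]: "leaves_labeled (Leaf j) i = (if j = i then {[]} else {})"
proof -
  have "subtree_at x (Leaf j) = Some (Leaf i) \<longleftrightarrow> x = [] \<and> j = i" for x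
    by (cases x) auto
  then show ?thesis by (auto simp: leaves_labeled_def)
qed

lemma leaves_Leaf [simp]: "leaves (Leaf j) = {[]}"
proof -
  have "(\<exists>i. subtree_at x (Leaf j) = Some (Leaf i)) \<longleftrightarrow> x = []" for x
    by (cases x) auto
  then show ?thesis by (auto simp: leaves_def)
qed

lemma nodes_Leaf [simp]: "nodes (Leaf j) = {[]}"
proof -
  have "subtree_at x (Leaf j) \<noteq> None \<longleftrightarrow> x = []" for x
    by (cases x) auto
  then show ?thesis by (auto simp: nodes_def)
qed

lemma leaves_labeled_Branch [simp]:
  "leaves_labeled (Branch l r) i
     = (#) False ` leaves_labeled l i \<union> (#) True ` leaves_labeled r i"
proof -
  have "subtree_at x (Branch l r) = Some (Leaf i) \<longleftrightarrow>
      x \<in> (#) False ` leaves_labeled l i \<union> (#) True ` leaves_labeled r i" for x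
    by (cases x) (auto simp: leaves_labeled_def)
  then show ?thesis by (auto simp: leaves_labeled_def)
qed

lemma leaves_Branch [simp]:
  "leaves (Branch l r) = (#) False ` leaves l \<union> (#) True ` leaves r"
proof -
  have "(\<exists>i. subtree_at x (Branch l r) = Some (Leaf i)) \<longleftrightarrow>
      x \<in> (#) False ` leaves l \<union> (#) True ` leaves r" for x
    by (cases x) (auto simp: leaves_def)
  then show ?thesis by (auto simp: leaves_def)
qed

lemma nodes_Branch [simp]:
  "nodes (Branch l r) = insert [] ((#) False ` nodes l \<union> (#) True ` nodes r)"
proof -
  have "subtree_at x (Branch l r) \<noteq> None \<longleftrightarrow>
      x \<in> insert [] ((#) False ` nodes l \<union> (#) True ` nodes r)" for x
    by (cases x) (auto simp: nodes_def)
  then show ?thesis by (auto simp: nodes_def)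
qed

lemma sum_Cons_image:
  assumes "finite X" "finite Y"
  shows "sum g ((#) False ` X \<union> (#) True ` Y)
    = (\<Sum>x\<in>X. g (False # x)) + (\<Sum>x\<in>Y. g (True # x))"
  using assms by (subst sum.union_disjoint) (auto simp: sum.reindex inj_on_def)

lemma card_Cons_image:
  assumes "finite X" "finite Y"
  shows "card ((#) False ` X \<union> (#) True ` Y) = card X + card Y"
  using sum_Cons_image[OF assms, of "\<lambda>_. 1 :: nat"] by (simp only: card_eq_sum)

lemma label_in_labels: "subtree_at x t = Some (Leaf i) \<Longrightarrow> i \<in> labels t"
  by (induction x t rule: subtree_at.induct) (auto split: ddg.splits if_splits)

lemma leaves_eq_Union:
  assumes "labels t \<subseteq> A"
  shows "leaves t = (\<Union>i\<in>A. leaves_labeled t i)"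
  using assms label_in_labels[of _ t] by (fastforce simp: leaves_def leaves_labeled_def)

lemma leaves_labeled_subset: "leaves_labeled t i \<subseteq> leaves t"
  by (auto simp: leaves_def leaves_labeled_def)

lemma leaves_labeled_disjoint:
  "i \<noteq> j \<Longrightarrow> leaves_labeled t i \<inter> leaves_labeled t j = {}"
  by (auto simp: leaves_labeled_def)

lemma finite_bool_lists_le: "finite {x :: bool list. length x \<le> k}"
  using finite_lists_length_le[of "UNIV :: bool set" k] by simp

section \<open>Finite trees\<close>

text \<open>Defined on sets of paths, so that it serves for all leaves of a tree and for the leaves
  of one label alike. On an infinite set the sum is 0 by convention, so finiteness is always secured
  first.\<close>

definition leaf_mass :: "bool list set \<Rightarrow> real" where
  "leaf_mass X = (\<Sum>x\<in>X. 1 / 2 ^ length x)"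

definition leaf_cost :: "bool list set \<Rightarrow> real" where
  "leaf_cost X = (\<Sum>x\<in>X. real (length x) / 2 ^ length x)"

lemma leaf_mass_Cons_image:
  assumes "finite X" "finite Y"
  shows "leaf_mass ((#) False ` X \<union> (#) True ` Y) = (leaf_mass X + leaf_mass Y) / 2"
  unfolding leaf_mass_def sum_Cons_image[OF assms]
  by (simp add: sum_divide_distrib add_divide_distrib field_simps)

lemma leaf_cost_Cons_image:
  assumes "finite X" "finite Y"
  shows "leaf_cost ((#) False ` X \<union> (#) True ` Y)
    = (leaf_cost X + leaf_mass X + leaf_cost Y + leaf_mass Y) / 2"
  unfolding leaf_mass_def leaf_cost_def sum_Cons_image[OF assms]
  by (simp add: sum_divide_distrib add_divide_distrib sum.distrib algebra_simps)

text \<open>Kraft's inequality with its equality case. The mass of a branch is the mean of the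
  masses of its children, so mass 1 passes to both. A bound on the leaves alone does not bound the
  nodes, since an infinite tree may have subtrees without leaves; mass 1 excludes these.\<close>

lemma leaf_mass_le_1:
  assumes "\<forall>x\<in>leaves t. length x \<le> k"
  shows "leaf_mass (leaves t) \<le> 1 \<and>
    (leaf_mass (leaves t) = 1 \<longrightarrow> (\<forall>x\<in>nodes t. length x \<le> k))"
  using assms
proof (induction k arbitrary: t)
  case 0
  show ?case
  proof (cases t)
    case (Branch l r)
    have "leaves t = {}"
      using 0 unfolding Branch leaves_Branch by blast
    then show ?thesis by (simp add: leaf_mass_def)
  qed (simp add: leaf_mass_def)
next
  case (Suc k)
  show ?case
  proof (cases t)
    case (Leaf i)
    then show ?thesis by (simp add: leaf_mass_def)
  next
    case (Branch l r)
    have l: "\<forall>x\<in>leaves l. length x \<le> k" and r: "\<forall>x\<in>leaves r. length x \<le> k"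
      using Suc.prems by (simp_all add: Branch ball_Un)
    have "finite (leaves l)" "finite (leaves r)"
      using l r by (auto intro: finite_subset[OF _ finite_bool_lists_le[of k]])
    then have "leaf_mass (leaves t) = (leaf_mass (leaves l) + leaf_mass (leaves r)) / 2"
      by (simp add: Branch leaf_mass_Cons_image)
    then show ?thesis
      using Suc.IH[OF l] Suc.IH[OF r] by (auto simp: Branch)
  qed
qed

text \<open>A full binary tree has one leaf more than it has internal nodes. The induction is on a
  depth bound, as a codatatype has no structural induction.\<close>

lemma card_nodes:
  assumes "\<forall>x\<in>nodes t. length x \<le> k"
  shows "finite (nodes t) \<and> finite (leaves t) \<and> card (nodes t) + 1 = 2 * card (leaves t)"
  using assms
proof (induction k arbitrary: t)
  case 0
  then show ?case
  proof (cases t)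
    case (Branch l r)
    have "[] \<in> nodes l" by (simp add: nodes_def)
    with 0 show ?thesis by (auto simp: Branch)
  qed simp
next
  case (Suc k)
  show ?case
  proof (cases t)
    case (Branch l r)
    have "\<forall>x\<in>nodes l. length x \<le> k" "\<forall>x\<in>nodes r. length x \<le> k"
      using Suc.prems by (simp_all add: Branch ball_Un)
    note IH = this[THEN Suc.IH]
    then have "card (nodes t) = Suc (card (nodes l) + card (nodes r))"
      by (simp add: Branch card_Cons_image image_iff)
    then show ?thesis
      using IH by (simp add: Branch card_Cons_image)
  qed simp
qed

section \<open>A tree that realizes the binary expansions\<close>

text \<open>
  \<open>binary_cost k x / 2 ^ k\<close> is the sum of \<open>d / 2 ^ d\<close> over the positions \<open>d\<close> of the ones in the
  binary expansion of \<open>x / 2 ^ k\<close>: a bit of weight \<open>2 ^ b\<close> in \<open>x\<close> has position \<open>k - b\<close>, and it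
  survives in \<open>k - b\<close> of the residues.
\<close>

definition binary_cost :: "nat \<Rightarrow> nat \<Rightarrow> nat" where
  "binary_cost k x = (\<Sum>j=1..k. x mod 2 ^ j)"

text \<open>The lowest bit occurs in all \<open>Suc k\<close> residues; the other bits reappear,
  doubled, in the residues of \<open>x div 2\<close>. This matches the tree construction, which
  removes the lowest level.\<close>

lemma binary_cost_Suc:
  "binary_cost (Suc k) x = Suc k * (x mod 2) + 2 * binary_cost k (x div 2)"
proof -
  have "binary_cost (Suc k) x = (\<Sum>j=0..k. x mod 2 ^ Suc j)"
    unfolding binary_cost_def using sum.atLeast_Suc_atMost_Suc_shift[of "\<lambda>j. x mod 2 ^ j" 0 k]
    by (simp add: comp_def)
  also have "\<dots> = (\<Sum>j=0..k. x mod 2 + 2 * (x div 2 mod 2 ^ j))"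
    by (intro sum.cong) (simp_all add: mod_mult2_eq)
  also have "\<dots> = Suc k * (x mod 2) + 2 * (\<Sum>j=0..k. x div 2 mod 2 ^ j)"
    by (simp add: sum.distrib sum_distrib_left)
  also have "(\<Sum>j=0..k. x div 2 mod 2 ^ j) = binary_cost k (x div 2)"
    unfolding binary_cost_def by (subst sum.atLeast_Suc_atMost) auto
  finally show ?thesis .
qed

text \<open>Mass 1 means that sampling in such a tree halts almost surely, so reading one more bit
  before it adds exactly 1 to its expected cost.\<close>

definition complete_over :: "'a set \<Rightarrow> 'a ddg \<Rightarrow> bool" where
  "complete_over A t \<longleftrightarrow> labels t \<subseteq> A \<and> finite (leaves t) \<and> leaf_mass (leaves t) = 1"

lemma finite_leaves_labeled: "complete_over A t \<Longrightarrow> finite (leaves_labeled t i)"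
  unfolding complete_over_def using leaves_labeled_subset[of t i] finite_subset by blast

lemma complete_over_Branch:
  assumes "complete_over A l" "complete_over A r"
  shows "complete_over A (Branch l r)"
  using assms by (auto simp: complete_over_def leaf_mass_Cons_image)

text \<open>Consecutive trees become the children of a new root. This halves every sum of label
  masses; the term \<open>length F\<close> is the one extra bit that each tree of mass 1 now
  costs.\<close>

lemma pair_up_forest:
  assumes "even (length F)" "\<forall>t\<in>set F. complete_over A t"
  shows "\<exists>G. 2 * length G = length F \<and> (\<forall>t\<in>set G. complete_over A t) \<and>
    (\<forall>i. 2 * (\<Sum>t\<leftarrow>G. leaf_mass (leaves_labeled t i)) = (\<Sum>t\<leftarrow>F. leaf_mass (leaves_labeled t i))) \<and>
    2 * (\<Sum>t\<leftarrow>G. leaf_cost (leaves t)) = (\<Sum>t\<leftarrow>F. leaf_cost (leaves t)) + length F"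
  using assms
proof (induction F rule: induct_list012)
  case 1
  then show ?case by auto
next
  case (2 t)
  then show ?case by simp
next
  case (3 l r F)
  then obtain G where G: "2 * length G = length F" "\<forall>t\<in>set G. complete_over A t"
    "\<forall>i. 2 * (\<Sum>t\<leftarrow>G. leaf_mass (leaves_labeled t i)) = (\<Sum>t\<leftarrow>F. leaf_mass (leaves_labeled t i))"
    "2 * (\<Sum>t\<leftarrow>G. leaf_cost (leaves t)) = (\<Sum>t\<leftarrow>F. leaf_cost (leaves t)) + length F"
    by auto
  have l: "complete_over A l" and r: "complete_over A r"
    using 3 by auto
  have "2 * leaf_mass (leaves_labeled (Branch l r) i)
      = leaf_mass (leaves_labeled l i) + leaf_mass (leaves_labeled r i)" for i
    using finite_leaves_labeled[OF l] finite_leaves_labeled[OF r] by (simp add: leaf_mass_Cons_image)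
  moreover have "2 * leaf_cost (leaves (Branch l r)) = leaf_cost (leaves l) + leaf_cost (leaves r) + 2"
    using l r by (simp add: complete_over_def leaf_cost_Cons_image)
  ultimately show ?case
    using G complete_over_Branch[OF l r]
    by (intro exI[of _ "Branch l r # G"]) (simp add: algebra_simps del: leaves_Branch leaves_labeled_Branch)
qed

text \<open>
  The trees in \<open>F\<close> are hung at level \<open>k\<close>, next to the leaves that the last bits of the \<open>c i\<close> ask
  for.  Pairing them all up leaves the same problem at level \<open>k - 1\<close>.
\<close>

lemma ex_tree_of_forest:
  assumes "finite A" "(\<Sum>i\<in>A. c i) + length F = 2 ^ k" "\<forall>t\<in>set F. complete_over A t"
  shows "\<exists>t. complete_over A t \<and>
    (\<forall>i\<in>A. 2 ^ k * leaf_mass (leaves_labeled t i)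
       = real (c i) + (\<Sum>t\<leftarrow>F. leaf_mass (leaves_labeled t i))) \<and>
    2 ^ k * leaf_cost (leaves t)
      = real (\<Sum>i\<in>A. binary_cost k (c i)) + (\<Sum>t\<leftarrow>F. leaf_cost (leaves t)) + real (k * length F)"
  using assms
proof (induction k arbitrary: c F)
  case 0
  \<comment> \<open>Total 1 leaves two cases: one weight is 1 and the tree is that leaf, or
    \<open>F\<close> is a single tree, which is the witness itself.\<close>
  show ?case
  proof (cases F)
    case Nil
    with 0 have "sum c A = 1" by simp
    then obtain i where i: "i \<in> A" "c i = 1" "\<forall>j\<in>A. j \<noteq> i \<longrightarrow> c j = 0"
      using sum_eq_1_iff[OF \<open>finite A\<close>, of c] by auto
    then show ?thesis
      by (intro exI[of _ "Leaf i"])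
        (auto simp: Nil complete_over_def leaf_mass_def leaf_cost_def binary_cost_def)
  next
    case (Cons t F')
    with 0 have "F' = []" "\<forall>i\<in>A. c i = 0" by auto
    with 0 show ?thesis
      by (intro exI[of _ t]) (auto simp: Cons binary_cost_def)
  qed
next
  case (Suc k)
  define R where "R = {i \<in> A. odd (c i)}"
  have "finite R" unfolding R_def using \<open>finite A\<close> by auto
  then obtain rs where rs: "set rs = R" "distinct rs"
    using finite_distinct_list by blast
  define H where "H = F @ map Leaf rs"
  have odd_sum: "(\<Sum>i\<in>A. c i mod 2) = length rs"
  proof -
    have "(\<Sum>i\<in>A. c i mod 2) = (\<Sum>i\<in>A. if odd (c i) then 1 else 0)"
      by (intro sum.cong) (auto simp: odd_iff_mod_2_eq_one)
    also have "\<dots> = card R"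
      using \<open>finite A\<close> by (simp add: R_def sum.If_cases Int_def)
    finally show ?thesis using rs distinct_card by metis
  qed
  have split: "(\<Sum>i\<in>A. c i) = (\<Sum>i\<in>A. c i mod 2) + 2 * (\<Sum>i\<in>A. c i div 2)"
    unfolding sum_distrib_left sum.distrib[symmetric] by (intro sum.cong) auto
  \<comment> \<open>The total is even and so is the part from the halved weights, so
    \<open>H\<close> can be paired up completely.\<close>
  have len: "length H + 2 * (\<Sum>i\<in>A. c i div 2) = 2 * 2 ^ k"
    using Suc.prems(2) split odd_sum by (simp add: H_def)
  then have "even (length H)"
    by presburger
  moreover have "\<forall>t\<in>set H. complete_over A t"
    using Suc.prems(3) rs by (auto simp: H_def R_def complete_over_def leaf_mass_def)
  ultimately have "\<exists>G. 2 * length G = length H \<and> (\<forall>t\<in>set G. complete_over A t) \<and>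
    (\<forall>i. 2 * (\<Sum>t\<leftarrow>G. leaf_mass (leaves_labeled t i)) = (\<Sum>t\<leftarrow>H. leaf_mass (leaves_labeled t i))) \<and>
    2 * (\<Sum>t\<leftarrow>G. leaf_cost (leaves t)) = (\<Sum>t\<leftarrow>H. leaf_cost (leaves t)) + length H"
    by (rule pair_up_forest)
  then obtain G where G: "2 * length G = length H" "\<forall>t\<in>set G. complete_over A t"
    "\<forall>i. 2 * (\<Sum>t\<leftarrow>G. leaf_mass (leaves_labeled t i)) = (\<Sum>t\<leftarrow>H. leaf_mass (leaves_labeled t i))"
    "2 * (\<Sum>t\<leftarrow>G. leaf_cost (leaves t)) = (\<Sum>t\<leftarrow>H. leaf_cost (leaves t)) + length H"
    by (elim exE conjE)
  have "(\<Sum>i\<in>A. c i div 2) + length G = 2 ^ k"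
    using len G(1) by simp
  from Suc.IH[OF \<open>finite A\<close> this G(2)] obtain t where t: "complete_over A t"
    "\<And>i. i \<in> A \<Longrightarrow> 2 ^ k * leaf_mass (leaves_labeled t i)
       = real (c i div 2) + (\<Sum>t\<leftarrow>G. leaf_mass (leaves_labeled t i))"
    "2 ^ k * leaf_cost (leaves t) = real (\<Sum>i\<in>A. binary_cost k (c i div 2))
       + (\<Sum>t\<leftarrow>G. leaf_cost (leaves t)) + real (k * length G)"
    by blast
  have "2 ^ Suc k * leaf_mass (leaves_labeled t i)
      = real (c i) + (\<Sum>t\<leftarrow>F. leaf_mass (leaves_labeled t i))" if "i \<in> A" for i
  proof -
    have "(\<Sum>t\<leftarrow>map Leaf rs. leaf_mass (leaves_labeled t i)) = (\<Sum>j\<leftarrow>rs. if j = i then 1 else 0)"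
      by (auto simp: comp_def leaf_mass_def intro!: arg_cong[where f = sum_list])
    also have "\<dots> = (\<Sum>j\<in>R. if j = i then 1 else 0)"
      using rs by (simp add: sum_list_distinct_conv_sum_set)
    also have "\<dots> = real (c i mod 2)"
      using \<open>finite R\<close> that by (auto simp: R_def odd_iff_mod_2_eq_one)
    finally have "(\<Sum>t\<leftarrow>H. leaf_mass (leaves_labeled t i))
        = (\<Sum>t\<leftarrow>F. leaf_mass (leaves_labeled t i)) + real (c i mod 2)"
      by (simp add: H_def)
    moreover have "real (c i) = real (c i mod 2) + 2 * real (c i div 2)"
      by (metis mod_mult_div_eq of_nat_add of_nat_mult of_nat_numeral)
    ultimately show ?thesis
      using t(2)[OF that] G(3)[rule_format, of i] by simp
  qed
  moreover have "2 ^ Suc k * leaf_cost (leaves t) = real (\<Sum>i\<in>A. binary_cost (Suc k) (c i))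
      + (\<Sum>t\<leftarrow>F. leaf_cost (leaves t)) + real (Suc k * length F)"
  proof -
    \<comment> \<open>Single leaves cost nothing themselves. Their depth enters through
      \<open>Suc k * length H\<close>, which splits into the share of \<open>F\<close> and the share
      \<open>Suc k * length rs\<close> of the lowest bits.\<close>
    have "(\<Sum>t\<leftarrow>map Leaf rs. leaf_cost (leaves t)) = 0"
      by (simp add: comp_def leaf_cost_def)
    then have "(\<Sum>t\<leftarrow>H. leaf_cost (leaves t)) = (\<Sum>t\<leftarrow>F. leaf_cost (leaves t))"
      by (simp add: H_def)
    moreover have "(\<Sum>i\<in>A. binary_cost (Suc k) (c i))
        = Suc k * length rs + 2 * (\<Sum>i\<in>A. binary_cost k (c i div 2))"
      unfolding binary_cost_Suc sum.distrib sum_distrib_left[symmetric] odd_sum ..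
    moreover have "2 * real (k * length G) = real (k * length H)"
      using G(1) by (metis mult.left_commute of_nat_mult of_nat_numeral)
    moreover have "real (length H) = real (length F) + real (length rs)"
      by (simp add: H_def)
    ultimately show ?thesis
      using t(3) G(4) by (simp add: algebra_simps)
  qed
  ultimately show ?case
    using t(1) by blast
qed

text \<open>The construction is started with the empty forest. The tree is the competitor that
  bounds the cost of an entropy-optimal tree from above.\<close>

lemma ex_tree_binary_cost:
  assumes "finite A" "(\<Sum>i\<in>A. c i) = 2 ^ k"
  shows "\<exists>t. ddg_tree_over A t \<and> has_output_distribution A t (\<lambda>i. real (c i) / 2 ^ k) \<and>
    expected_bits t = ennreal (real (\<Sum>i\<in>A. binary_cost k (c i)) / 2 ^ k)"
proof -
  obtain t where t: "complete_over A t"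
    "\<And>i. i \<in> A \<Longrightarrow> 2 ^ k * leaf_mass (leaves_labeled t i) = real (c i)"
    "2 ^ k * leaf_cost (leaves t) = real (\<Sum>i\<in>A. binary_cost k (c i))"
    using ex_tree_of_forest[of A c "[]" k] assms by auto
  have "has_output_distribution A t (\<lambda>i. real (c i) / 2 ^ k)"
    unfolding has_output_distribution_def
    using finite_leaves_labeled[OF t(1)] t(2)
    by (auto simp: leaf_mass_def field_simps intro!: has_sum_finiteI)
  moreover have "expected_bits t = ennreal (leaf_cost (leaves t))"
    using t(1) by (simp add: expected_bits_def complete_over_def leaf_cost_def sum_ennreal)
  moreover have "leaf_cost (leaves t) = real (\<Sum>i\<in>A. binary_cost k (c i)) / 2 ^ k"
    using t(3) by (simp add: field_simps)
  ultimately show ?thesis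
    using t(1) by (auto simp: complete_over_def ddg_tree_over_def)
qed

section \<open>Lower bounds for the tails\<close>

lemma has_sum_sum:
  fixes f :: "'i \<Rightarrow> 'a \<Rightarrow> 'b :: topological_comm_monoid_add"
  assumes "\<And>j. j \<in> J \<Longrightarrow> (f j has_sum s j) L"
  shows "((\<lambda>x. \<Sum>j\<in>J. f j x) has_sum (\<Sum>j\<in>J. s j)) L"
  using assms by (induction J rule: infinite_finite_induct) (auto intro: has_sum_add)

text \<open>Level \<open>j\<close> is included, so among the tails with \<open>1 \<le> j\<close> a
  leaf at level \<open>d\<close> lies in exactly the first \<open>d\<close>. The sum is infinite
  because an arbitrary tree is not known to be finite.\<close>

definition tail_mass :: "bool list set \<Rightarrow> nat \<Rightarrow> real" where
  "tail_mass L j = (\<Sum>\<^sub>\<infinity>x\<in>{x \<in> L. j \<le> length x}. 1 / 2 ^ length x)"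

lemma tail_mass_nonneg: "0 \<le> tail_mass L j"
  unfolding tail_mass_def by (intro infsum_nonneg) simp

lemma sum_le_tail_mass:
  assumes "(\<lambda>x. 1 / 2 ^ length x :: real) summable_on L"
    and "finite X" "X \<subseteq> L" "\<forall>x\<in>X. j \<le> length x"
  shows "(\<Sum>x\<in>X. 1 / 2 ^ length x) \<le> tail_mass L j"
  unfolding tail_mass_def using assms
  by (intro finite_sum_le_infsum summable_on_subset[OF assms(1)]) auto

text \<open>
  Above level \<open>j\<close> the mass is a multiple of \<open>2 ^ (1 - j)\<close>, so the leaves from level \<open>j\<close> on must
  carry at least the remainder of \<open>c / 2 ^ k\<close> modulo \<open>2 ^ (1 - j)\<close>.
\<close>

lemma tail_mass_ge:
  assumes "((\<lambda>x. 1 / 2 ^ length x) has_sum (real c / 2 ^ k)) L" and "1 \<le> j" "j \<le> Suc k"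
  shows "real (c mod 2 ^ (Suc k - j)) \<le> 2 ^ k * tail_mass L j"
proof -
  define H where "H = {x \<in> L. length x < j}"
  \<comment> \<open>The mass above level \<open>j\<close> in units of
    \<open>1 / 2 ^ (j - 1)\<close>, an integer because these leaves have level at most
    \<open>j - 1\<close>.\<close>
  define u where "u = (\<Sum>x\<in>H. 2 ^ (j - 1 - length x) :: nat)"
  let ?q = "2 ^ (Suc k - j) :: nat"
  have "finite H"
    by (rule finite_subset[OF _ finite_bool_lists_le[of j]]) (auto simp: H_def)
  have "(\<lambda>x. 1 / 2 ^ length x :: real) summable_on {x \<in> L. j \<le> length x}"
    by (rule summable_on_subset[OF has_sum_imp_summable[OF assms(1)]]) auto
  then have "((\<lambda>x. 1 / 2 ^ length x) has_sum ((\<Sum>x\<in>H. 1 / 2 ^ length x) + tail_mass L j))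
      (H \<union> {x \<in> L. j \<le> length x})"
    unfolding tail_mass_def using \<open>finite H\<close>
    by (intro has_sum_Un_disjoint) (auto simp: H_def)
  moreover have "H \<union> {x \<in> L. j \<le> length x} = L"
    by (auto simp: H_def)
  ultimately have "(\<Sum>x\<in>H. 1 / 2 ^ length x) + tail_mass L j = real c / 2 ^ k"
    using assms(1) has_sum_unique by metis
  moreover have "2 ^ k * (\<Sum>x\<in>H. 1 / 2 ^ length x) = real (u * ?q)"
  proof -
    have "2 ^ k * (1 / 2 ^ length x) = (2 ^ (j - 1 - length x) * 2 ^ (Suc k - j) :: real)"
      if "x \<in> H" for x
    proof -
      have "k = length x + (j - 1 - length x) + (Suc k - j)"
        using that assms(2,3) by (auto simp: H_def)
      then have "(2::real) ^ k = 2 ^ length x * 2 ^ (j - 1 - length x) * 2 ^ (Suc k - j)"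
        by (metis power_add)
      then show ?thesis by simp
    qed
    then show ?thesis
      by (simp add: u_def sum_distrib_left sum_distrib_right)
  qed
  ultimately have eq: "real (u * ?q) + 2 ^ k * tail_mass L j = real c"
    by (simp add: field_simps)
  then have "real (u * ?q) \<le> real c"
    using mult_nonneg_nonneg[OF zero_le_power tail_mass_nonneg, of 2 k L j] by linarith
  then have "u * ?q \<le> c"
    by (simp only: of_nat_le_iff)
  \<comment> \<open>\<open>v\<close> is the scaled tail; it is congruent to \<open>c\<close> modulo
    \<open>?q\<close>, hence at least the remainder.\<close>
  then obtain v where v: "c = u * ?q + v"
    using le_Suc_ex by blast
  then have "c mod ?q \<le> v"
    by simp
  moreover have "2 ^ k * tail_mass L j = real v"
    using eq v by simp
  ultimately show ?thesis
    by (simp only: of_nat_le_iff)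
qed

text \<open>Exchange of summation: a leaf at level \<open>d\<close> is counted once for each
  \<open>j\<close> up to \<open>d\<close>, and stopping at \<open>n\<close> only drops
  terms.\<close>

lemma sum_tail_mass_le:
  assumes "(\<lambda>x. 1 / 2 ^ length x :: real) summable_on L"
    and "(\<lambda>x. real (length x) / 2 ^ length x) summable_on L"
  shows "(\<Sum>j=1..n. tail_mass L j) \<le> (\<Sum>\<^sub>\<infinity>x\<in>L. real (length x) / 2 ^ length x)"
proof (rule has_sum_mono)
  let ?g = "\<lambda>j x. if j \<le> length x then 1 / 2 ^ length x else 0 :: real"
  show "((\<lambda>x. \<Sum>j=1..n. ?g j x) has_sum (\<Sum>j=1..n. tail_mass L j)) L"
  proof (rule has_sum_sum)
    fix j
    have "(\<lambda>x. 1 / 2 ^ length x :: real) summable_on {x \<in> L. j \<le> length x}"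
      by (rule summable_on_subset[OF assms(1)]) auto
    then have "((\<lambda>x. 1 / 2 ^ length x) has_sum tail_mass L j) {x \<in> L. j \<le> length x}"
      unfolding tail_mass_def by simp
    then show "(?g j has_sum tail_mass L j) L"
      by (subst has_sum_cong_neutral[where T = "{x \<in> L. j \<le> length x}"
            and g = "\<lambda>x. 1 / 2 ^ length x"]) auto
  qed
  show "((\<lambda>x. real (length x) / 2 ^ length x) has_sum
      (\<Sum>\<^sub>\<infinity>x\<in>L. real (length x) / 2 ^ length x)) L"
    using assms(2) by simp
  show "(\<Sum>j=1..n. ?g j x) \<le> real (length x) / 2 ^ length x" for x :: "bool list"
  proof -
    have "(\<Sum>j=1..n. ?g j x) = (\<Sum>j\<in>{1..n} \<inter> {..length x}. 1 / 2 ^ length x)"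
      by (subst sum.inter_restrict) auto
    also have "\<dots> = real (card ({1..n} \<inter> {..length x})) / 2 ^ length x"
      by simp
    also have "\<dots> \<le> real (length x) / 2 ^ length x"
      using card_mono[of "{1..length x}" "{1..n} \<inter> {..length x}"]
      by (intro divide_right_mono) auto
    finally show ?thesis .
  qed
qed

text \<open>Identifies the sum of the lower bounds with the cost of the competitor. The index
  \<open>Suc k\<close> adds a zero term, but its tail is the one that detects leaves below level
  \<open>k\<close>.\<close>

lemma binary_cost_rev: "(\<Sum>j=1..Suc k. c mod 2 ^ (Suc k - j)) = binary_cost k c"
proof -
  have "(\<Sum>j=1..Suc k. c mod 2 ^ (Suc k - j)) = (\<Sum>j=0..k. c mod 2 ^ j)"
    by (rule sum.reindex_bij_witness[of _ "\<lambda>j. Suc k - j" "\<lambda>j. Suc k - j"]) auto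
  then show ?thesis
    unfolding binary_cost_def by (simp add: sum.atLeast_Suc_atMost)
qed

text \<open>Passage from the extended-valued series to a real one: a finite bound on the cost bounds
  all finite partial sums.\<close>

lemma finite_expected_bits:
  assumes "expected_bits t \<le> ennreal e" "0 \<le> e"
  shows "(\<lambda>x. real (length x) / 2 ^ length x) summable_on leaves t"
    and "(\<Sum>\<^sub>\<infinity>x\<in>leaves t. real (length x) / 2 ^ length x) \<le> e"
proof -
  have le: "(\<Sum>x\<in>F. real (length x) / 2 ^ length x) \<le> e" if "finite F" "F \<subseteq> leaves t" for F
  proof -
    have "ennreal (\<Sum>x\<in>F. real (length x) / 2 ^ length x)
        = (\<Sum>x\<in>F. ennreal (real (length x) / 2 ^ length x))"
      by (simp add: sum_ennreal)
    also have "\<dots> \<le> expected_bits t"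
      unfolding expected_bits_def infsum_finite[OF that(1), symmetric] using that(2)
      by (intro infsum_mono_neutral nonneg_summable_on_complete) auto
    also note assms(1)
    finally show ?thesis
      using assms(2) by (simp only: ennreal_le_iff)
  qed
  show "(\<lambda>x. real (length x) / 2 ^ length x) summable_on leaves t"
    using le by (intro nonneg_bdd_above_summable_on bdd_aboveI[of _ e]) auto
  then show "(\<Sum>\<^sub>\<infinity>x\<in>leaves t. real (length x) / 2 ^ length x) \<le> e"
    using le by (rule infsum_le_finite_sums)
qed

section \<open>Shape of an entropy-optimal tree for a dyadic distribution\<close>

text \<open>The competitor's cost equals the sum of the lower bounds for the tails, so each bound is
  attained. The tail from level \<open>Suc k\<close> is then empty, and the tail from level
  \<open>j\<close> is too light for two leaves at level \<open>j\<close>.\<close>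

lemma entropy_optimal_dyadic:
  assumes "finite A" "(\<Sum>i\<in>A. c i) = 2 ^ k"
    and opt: "entropy_optimal A (\<lambda>i. real (c i) / 2 ^ k) t"
  shows "\<forall>x\<in>leaves t. length x \<le> k"
    and "\<forall>i\<in>A. inj_on length (leaves_labeled t i)"
proof -
  let ?L = "leaves_labeled t"
  let ?f = "\<lambda>x :: bool list. real (length x) / 2 ^ length x"
  have leaves: "leaves t = (\<Union>i\<in>A. ?L i)"
    using opt by (intro leaves_eq_Union) (simp add: entropy_optimal_def ddg_tree_over_def)
  have dist: "((\<lambda>x. 1 / 2 ^ length x) has_sum (real (c i) / 2 ^ k)) (?L i)" if "i \<in> A" for i
    using opt that by (simp add: entropy_optimal_def has_output_distribution_def)
  note mass_summable = has_sum_imp_summable[OF dist]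
  have "expected_bits t \<le> ennreal (real (\<Sum>i\<in>A. binary_cost k (c i)) / 2 ^ k)"
    using opt ex_tree_binary_cost[OF assms(1,2)] by (metis entropy_optimal_def)
  moreover have "0 \<le> real (\<Sum>i\<in>A. binary_cost k (c i)) / 2 ^ k"
    by (simp add: sum_nonneg)
  ultimately have f: "?f summable_on leaves t"
    "infsum ?f (leaves t) \<le> real (\<Sum>i\<in>A. binary_cost k (c i)) / 2 ^ k"
    by (rule finite_expected_bits)+
  have f_label: "?f summable_on ?L i" for i
    using summable_on_subset[OF f(1) leaves_labeled_subset] .
  have "(?f has_sum (\<Sum>i\<in>A. infsum ?f (?L i))) (leaves t)"
    unfolding leaves using \<open>finite A\<close>
    by (intro sum_has_sum has_sum_infsum f_label leaves_labeled_disjoint)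
  then have "(\<Sum>i\<in>A. infsum ?f (?L i)) \<le> real (\<Sum>i\<in>A. binary_cost k (c i)) / 2 ^ k"
    using f(2) by (simp only: infsumI)
  moreover have "(\<Sum>i\<in>A. \<Sum>j=1..Suc k. tail_mass (?L i) j) \<le> (\<Sum>i\<in>A. infsum ?f (?L i))"
    using f_label mass_summable by (intro sum_mono sum_tail_mass_le)
  ultimately have "(\<Sum>i\<in>A. \<Sum>j=1..Suc k. tail_mass (?L i) j)
      \<le> real (\<Sum>i\<in>A. binary_cost k (c i)) / 2 ^ k"
    by (rule order_trans[rotated])
  then have upper: "(\<Sum>i\<in>A. \<Sum>j=1..Suc k. 2 ^ k * tail_mass (?L i) j)
      \<le> (\<Sum>i\<in>A. \<Sum>j=1..Suc k. real (c i mod 2 ^ (Suc k - j)))"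
    unfolding sum_distrib_left[symmetric] of_nat_sum[symmetric] binary_cost_rev
    by (simp add: field_simps del: sum.cl_ivl_Suc)
  \<comment> \<open>The slack in each lower bound: nonnegative terms whose sum is at most 0 all
    vanish.\<close>
  define gap where "gap = (\<lambda>(i, j). 2 ^ k * tail_mass (?L i) j - real (c i mod 2 ^ (Suc k - j)))"
  have gap_nonneg: "\<forall>z\<in>A \<times> {1..Suc k}. 0 \<le> gap z"
    using tail_mass_ge[OF dist] by (auto simp: gap_def simp del: of_nat_Suc)
  have "sum gap (A \<times> {1..Suc k}) \<le> 0"
    using upper unfolding gap_def
    by (simp add: sum.cartesian_product[symmetric] sum_subtractf del: sum.cl_ivl_Suc)
  moreover have "0 \<le> sum gap (A \<times> {1..Suc k})"
    using gap_nonneg by (intro sum_nonneg) blast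
  ultimately have "sum gap (A \<times> {1..Suc k}) = 0"
    by (rule antisym)
  then have "\<forall>z\<in>A \<times> {1..Suc k}. gap z = 0"
    using gap_nonneg \<open>finite A\<close>
    by (subst (asm) sum_nonneg_eq_0_iff) (blast intro: finite_SigmaI finite_atLeastAtMost)+
  then have tail: "2 ^ k * tail_mass (?L i) j = real (c i mod 2 ^ (Suc k - j))"
    if "i \<in> A" "1 \<le> j" "j \<le> Suc k" for i j
    using that by (auto simp: gap_def)
  have level: "length x \<le> k" if "i \<in> A" "x \<in> ?L i" for i x
  proof (rule ccontr)
    assume "\<not> length x \<le> k"
    with that have "1 / 2 ^ length x \<le> tail_mass (?L i) (Suc k)"
      using sum_le_tail_mass[OF mass_summable, of i "{x}" "Suc k"] by simp
    \<comment> \<open>At \<open>j = Suc k\<close> the modulus is 1, so the remainder is 0.\<close>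
    moreover have "tail_mass (?L i) (Suc k) = 0"
      using tail[of i "Suc k"] that by simp
    moreover have "0 < 1 / (2 ^ length x :: real)"
      by simp
    ultimately show False
      by linarith
  qed
  then show "\<forall>x\<in>leaves t. length x \<le> k"
    by (auto simp: leaves)
  show "\<forall>i\<in>A. inj_on length (?L i)"
  proof (intro ballI inj_onI, rule ccontr)
    fix i x y
    assume *: "i \<in> A" "x \<in> ?L i" "y \<in> ?L i" "length x = length y" "x \<noteq> y"
    define j where "j = length x"
    have "j \<le> k"
      using level * by (simp add: j_def)
    have "j \<noteq> 0"
      using * by (auto simp: j_def)
    \<comment> \<open>Scaled by \<open>2 ^ k\<close>, the mass of two leaves at level
      \<open>j\<close> is the full modulus \<open>2 ^ (Suc k - j)\<close>, which no remainder
      reaches.\<close>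
    have "2 / 2 ^ j \<le> tail_mass (?L i) j"
      using sum_le_tail_mass[OF mass_summable[OF *(1)], of "{x, y}" j] * by (simp add: j_def)
    then have "2 ^ k * (2 / 2 ^ j) \<le> 2 ^ k * tail_mass (?L i) j"
      by (intro mult_left_mono) auto
    also have "\<dots> = real (c i mod 2 ^ (Suc k - j))"
      using tail *(1) \<open>j \<le> k\<close> \<open>j \<noteq> 0\<close> by simp
    also have "\<dots> < real (2 ^ (Suc k - j))"
      by (simp only: of_nat_less_iff) simp
    also have "\<dots> = 2 ^ k * (2 / 2 ^ j)"
      unfolding of_nat_power of_nat_numeral using \<open>j \<le> k\<close> by (simp add: power_diff)
    finally show False by simp
  qed
qed

section \<open>Counting the nodes\<close>

text \<open>The level maps the leaves of each label injectively into \<open>{1..k}\<close>, and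
  there are fewer than twice as many nodes as leaves. A tree that is a single leaf at level 0 is
  treated separately; there \<open>1 \<le> k\<close> makes room for its one node.\<close>

lemma card_nodes_entropy_optimal:
  assumes "finite A" "(\<Sum>i\<in>A. c i) = 2 ^ k" "1 \<le> k"
    and opt: "entropy_optimal A (\<lambda>i. real (c i) / 2 ^ k) t"
  shows "finite (nodes t) \<and> card (nodes t) \<le> 2 * card A * k"
proof (cases t)
  case (Leaf i)
  have "A \<noteq> {}"
    using assms(2) by auto
  with \<open>finite A\<close> have "1 \<le> card A"
    by (simp add: Suc_le_eq card_gt_0_iff)
  with \<open>1 \<le> k\<close> have "1 \<le> card A * k"
    by simp
  then show ?thesis
    by (simp add: Leaf)
next
  case (Branch l r)
  note level = entropy_optimal_dyadic(1)[OF assms(1,2) opt]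
  have leaves: "leaves t = (\<Union>i\<in>A. leaves_labeled t i)"
    using opt by (intro leaves_eq_Union) (simp add: entropy_optimal_def ddg_tree_over_def)
  have finite: "finite (leaves_labeled t i)" for i
    using level leaves_labeled_subset[of t i]
    by (intro finite_subset[OF _ finite_bool_lists_le[of k]]) auto
  \<comment> \<open>The probabilities add up to 1, so the equality case of Kraft's inequality bounds
    the depth of all nodes.\<close>
  have "leaf_mass (leaves t) = (\<Sum>i\<in>A. leaf_mass (leaves_labeled t i))"
    unfolding leaf_mass_def leaves using \<open>finite A\<close> finite
    by (intro sum.UNION_disjoint) (auto simp: leaves_labeled_disjoint)
  also have "\<dots> = (\<Sum>i\<in>A. real (c i) / 2 ^ k)"
    using opt finite
    by (intro sum.cong)
      (auto simp: leaf_mass_def entropy_optimal_def has_output_distribution_def has_sum_finite_iff)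
  also have "\<dots> = real (\<Sum>i\<in>A. c i) / 2 ^ k"
    by (simp add: sum_divide_distrib)
  finally have "leaf_mass (leaves t) = 1"
    using assms(2) by simp
  with level have "\<forall>x\<in>nodes t. length x \<le> k"
    using leaf_mass_le_1 by blast
  note nodes = card_nodes[OF this]
  have "card (leaves_labeled t i) \<le> k" if "i \<in> A" for i
  proof -
    have "length ` leaves_labeled t i \<subseteq> {1..k}"
    proof (intro subsetI, elim imageE)
      fix d x
      assume "d = length x" "x \<in> leaves_labeled t i"
      moreover from this have "x \<noteq> []"
        by (auto simp: Branch)
      ultimately show "d \<in> {1..k}"
        using level leaves_labeled_subset[of t i] by (cases x) fastforce+
    qed
    then have "card (leaves_labeled t i) \<le> card {1..k}"
      using entropy_optimal_dyadic(2)[OF assms(1,2) opt] that by (intro card_inj_on_le) auto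
    then show ?thesis by simp
  qed
  then have "card (leaves t) \<le> card A * k"
    unfolding leaves using card_UN_le[OF \<open>finite A\<close>, of "leaves_labeled t"]
      sum_bounded_above[of A "\<lambda>i. card (leaves_labeled t i)" k]
    by (simp add: order_trans)
  with nodes show ?thesis
    by simp
qed

theorem theorem5p1:
  fixes a :: "nat list" and n m :: nat and T :: "nat encoded_ddg"
  assumes "length a = n"
    and "\<forall>x\<in>set a. 0 < x"
    and "m = sum_list a"
    and "m > 1"
    and "is_fldr_tree a T"
  shows "finite (encoded_nodes T) \<and>
    int (card (encoded_nodes T)) \<le> 2 * (int n + 1) * \<lceil>log 2 (real m)\<rceil>"
proof -
  define k where "k = fldr_depth a"
  \<comment> \<open>The numerators over \<open>2 ^ k\<close>. The natural subtraction is exact,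
    since rounding up the logarithm gives \<open>m \<le> 2 ^ k\<close>.\<close>
  define c where "c = (\<lambda>i. if i = n + 1 then 2 ^ k - m else a ! (i - 1))"
  have "0 < log 2 (real m)"
    using \<open>m > 1\<close> by simp
  then have k: "int k = \<lceil>log 2 (real m)\<rceil>" "1 \<le> k"
    by (auto simp: k_def fldr_depth_def \<open>m = sum_list a\<close> le_nat_iff)
  have "log 2 (real m) \<le> real k"
    using k(1) by (metis le_of_int_ceiling of_int_of_nat_eq)
  then have "real m \<le> real (2 ^ k)"
    using \<open>m > 1\<close> by (simp add: log_le_iff powr_realpow)
  then have "m \<le> 2 ^ k"
    by (simp only: of_nat_le_iff)
  have "(\<Sum>i=1..n. c i) = (\<Sum>i<n. a ! i)"
    by (rule sum.reindex_bij_witness[of _ Suc "\<lambda>i. i - 1"]) (auto simp: c_def)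
  also have "\<dots> = m"
    using assms(1,3) by (simp add: sum_list_sum_nth atLeast0LessThan)
  finally have sum_c: "(\<Sum>i\<in>{1..n + 1}. c i) = 2 ^ k"
    using \<open>m \<le> 2 ^ k\<close> by (simp add: c_def)
  have proposal: "fldr_proposal a i = real (c i) / 2 ^ k" if "i \<in> {1..n + 1}" for i
    using that assms(1,3) \<open>m \<le> 2 ^ k\<close>
    by (auto simp: fldr_proposal_def c_def k_def[symmetric] diff_divide_distrib of_nat_diff)
  \<comment> \<open>Output distributions are compared on the outcome set alone, so both functions
    have the same competing trees and the same optimal ones.\<close>
  have "has_output_distribution {1..n + 1} t (fldr_proposal a)
      \<longleftrightarrow> has_output_distribution {1..n + 1} t (\<lambda>i. real (c i) / 2 ^ k)" for t
    unfolding has_output_distribution_def using proposal by (intro ball_cong) simp_all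
  then have "entropy_optimal {1..n + 1} (\<lambda>i. real (c i) / 2 ^ k) (underlying_tree T)"
    using \<open>is_fldr_tree a T\<close> \<open>length a = n\<close> by (simp add: is_fldr_tree_def entropy_optimal_def)
  from card_nodes_entropy_optimal[OF _ sum_c k(2) this]
  have nodes: "finite (encoded_nodes T)" "card (encoded_nodes T) \<le> 2 * (n + 1) * k"
    by (simp_all add: encoded_nodes_def)
  from nodes(2) have "int (card (encoded_nodes T)) \<le> int (2 * (n + 1) * k)"
    by (simp only: of_nat_le_iff)
  then show ?thesis
    using nodes(1) by (simp add: k(1)[symmetric] algebra_simps)
qed

end
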